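(* Let $\mathbb{K}$ be a field, $R=\mathbb{K}[x_1,\ldots,x_n]$ the standard graded polynomial ring, $I\subset R$ a homogeneous ideal, and $f\in R$ a homogeneous polynomial of degree $d>0$ such that $f\notin I$. Assume that $t_1^R(R/(I:f))\le d$. Let $\mathbf{F}_\bullet$ and $\mathbf{G}_\bullet$ be graded free resolutions (not necessarily minimal) of $R/I$ and $R/(I:f)$, respectively. If $\mathbf{F}_\bullet$ and $\mathbf{G}_\bullet$ satisfy the subadditivity condition, then the resolution obtained by the mapping cone construction (from $\mathbf{F}_\bullet$ and $\mathbf{G}_\bullet(-d)$) applied to the map $[R/(I:f)](-d)\xrightarrow{\cdot f}R/I$ satisfies the subadditivity condition.
   Context: For a finite graded free resolution $\mathbf{F}_\bullet: 0\to F_p\to\cdots\to F_1\to F_0\to M\to 0$ of a finitely generated graded $R$-module $M$ (not necessarily minimal), with $F_i=\bigoplus_j R(-j)^{b_{ij}}$, set $t_i^R(\mathbf{F}_\bullet)=\sup\{j : b_{ij}\ne 0\}$ (with $\sup\emptyset=-\infty$). When $\mathbf{F}_\bullet$ is the graded minimal free resolution of $M$, one writes $t_i^R(M)$ for $t_i^R(\mathbf{F}_\bullet)$. The resolution $\mathbf{F}_\bullet$ satisfies the subadditivity condition (subadditivity holds for $\mathbf{F}_\bullet$) if $t_{a+b}^R(\mathbf{F}_\bullet)\le t_a^R(\mathbf{F}_\bullet)+t_b^R(\mathbf{F}_\bullet)$ for all $a,b\ge 0$ with $a+b\le p$. Here $I:f=\{g\in R : gf\in I\}$. The mapping cone is built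 from a graded chain map $\mathbf{G}_\bullet(-d)\to\mathbf{F}_\bullet$ lifting multiplication by $f$; it is a graded free resolution of $R/(I,f)$ whose $i$-th free module is $F_i\oplus G_{i-1}(-d)$ for $i\ge 1$ and $F_0$ for $i=0$.
   Formalization: The formal theorem also assumes t_1(G) ≤ d for the given resolution G, not only t_1(R/(I:f)) ≤ d; without this the claim fails, e.g. I=0, f=x_1, F=R, G=(R(-2)→R(-2)→R) with maps 1 and 0, where the cone has t_1=1 and t_2=3. *)

theory Defs
  imports
    "HOL-Library.Poly_Mapping"
    "HOL-Library.Extended_Real"
    "Jordan_Normal_Form.Matrix"
begin

section \<open>The standard graded polynomial ring\<close>

text \<open>
  The polynomial ring in the variables \<open>x\<^sub>v\<close>, \<open>v :: 'n\<close>, with \<open>'n\<close> a finite type: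
  a polynomial is a finitely supported family of coefficients indexed by exponent vectors.
\<close>

type_synonym ('n, 'k) mpoly = "('n \<Rightarrow>\<^sub>0 nat) \<Rightarrow>\<^sub>0 'k"

definition mdeg :: "('n::finite \<Rightarrow>\<^sub>0 nat) \<Rightarrow> nat" where
  "mdeg m = (\<Sum>v\<in>UNIV. Poly_Mapping.lookup m v)"

text \<open>
  The degree is an integer, as differences of twists occur below. The zero polynomial is
  homogeneous of every degree and is the only one that is homogeneous of a negative degree.
\<close>

definition homogeneous :: "int \<Rightarrow> ('n::finite, 'k::zero) mpoly \<Rightarrow> bool" where
  "homogeneous e g \<longleftrightarrow> (\<forall>m\<in>Poly_Mapping.keys g. int (mdeg m) = e)"

text \<open>Ideals are the submodules of the ring as a module over itself.\<close>

definition homogeneous_ideal :: "('n::finite, 'k::field) mpoly set \<Rightarrow> bool" where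
  "homogeneous_ideal I \<longleftrightarrow>
     (\<exists>S. (\<forall>g\<in>S. \<exists>e. homogeneous e g) \<and> I = Modules.module.span (*) S)"

definition colon :: "('n, 'k::field) mpoly set \<Rightarrow> ('n, 'k) mpoly \<Rightarrow> ('n, 'k) mpoly set" where
  "colon I f = {g. g * f \<in> I}"


section \<open>Finite graded free resolutions of cyclic modules\<close>

text \<open>
  Data of a finite complex of free modules, over a ring \<open>'r\<close> of polynomials, with an augmentation to \<open>R/J\<close>,

  \<open>0 \<rightarrow> F\<^sub>p \<rightarrow> \<dots> \<rightarrow> F\<^sub>1 \<rightarrow> F\<^sub>0 \<rightarrow> R/J \<rightarrow> 0\<close>.

  Here \<open>p\<close> is \<open>len F\<close>, and \<open>twists F i\<close> lists, with multiplicity, the degrees of the elements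
  of a homogeneous basis of \<open>F\<^sub>i\<close>: if it is \<open>[j\<^sub>1, \<dots>, j\<^sub>r]\<close> then
  \<open>F\<^sub>i = R(-j\<^sub>1) \<oplus> \<dots> \<oplus> R(-j\<^sub>r)\<close>, so the multiplicity of \<open>j\<close> is \<open>b\<^sub>i\<^sub>j\<close>. Elements of \<open>F\<^sub>i\<close> are
  column vectors. Note the index shift: \<open>diff F i\<close> is the matrix of \<open>F\<^bsub>i+1\<^esub> \<rightarrow> F\<^sub>i\<close>.
  The augmentation is a homomorphism to \<open>R/J\<close> from a free module; it is given by polynomials
  \<open>aug F\<close> representing the images of the basis elements, so it maps \<open>v\<close> to the class of
  \<open>aug F \<bullet> v\<close>. Every homogeneous homomorphism of degree \<open>0\<close> from \<open>F\<^sub>0\<close> to \<open>R/J\<close> is of this form.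
\<close>

record 'r free_complex =
  len :: nat
  twists :: "nat \<Rightarrow> int list"
  diff :: "nat \<Rightarrow> 'r mat"
  aug :: "'r vec"

abbreviation rk :: "'r free_complex \<Rightarrow> nat \<Rightarrow> nat" where
  "rk F i \<equiv> length (twists F i)"

text \<open>
  \<open>homogeneous_mat ts ss A\<close>: multiplication by \<open>A\<close> is a homomorphism of degree \<open>0\<close> from
  \<open>\<Oplus>\<^sub>c R(-ss\<^sub>c)\<close> to \<open>\<Oplus>\<^sub>r R(-ts\<^sub>r)\<close>.
\<close>

definition homogeneous_mat :: "int list \<Rightarrow> int list \<Rightarrow> ('n::finite, 'k::field) mpoly mat \<Rightarrow> bool" where
  "homogeneous_mat ts ss A \<longleftrightarrow>
     A \<in> carrier_mat (length ts) (length ss) \<and>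
     (\<forall>r<length ts. \<forall>c<length ss. homogeneous (ss ! c - ts ! r) (A $$ (r, c)))"

definition graded_free_resolution ::
    "('n::finite, 'k::field) mpoly set \<Rightarrow> ('n, 'k) mpoly free_complex \<Rightarrow> bool" where
  "graded_free_resolution J F \<longleftrightarrow>
     (\<forall>i>len F. twists F i = []) \<and>
     (\<forall>i. homogeneous_mat (twists F i) (twists F (Suc i)) (diff F i)) \<and>
     aug F \<in> carrier_vec (rk F 0) \<and>
     (\<forall>r<rk F 0. homogeneous (twists F 0 ! r) (aug F $ r)) \<and>
     \<comment> \<open>exactness at \<open>R/J\<close>, at \<open>F\<^sub>0\<close>, and at \<open>F\<^bsub>i+1\<^esub>\<close>\<close>
     (\<forall>g. \<exists>v\<in>carrier_vec (rk F 0). g - aug F \<bullet> v \<in> J) \<and>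
     {v \<in> carrier_vec (rk F 0). aug F \<bullet> v \<in> J} = (\<lambda>w. diff F 0 *\<^sub>v w) ` carrier_vec (rk F 1) \<and>
     (\<forall>i. {v \<in> carrier_vec (rk F (Suc i)). diff F i *\<^sub>v v = 0\<^sub>v (rk F i)}
            = (\<lambda>w. diff F (Suc i) *\<^sub>v w) ` carrier_vec (rk F (Suc (Suc i))))"

text \<open>
  Minimality of a resolution: the image of each differential lies in
  \<open>(x\<^sub>1, \<dots>, x\<^sub>n) F\<^sub>i\<close>, i.e. the matrix entries have no constant term.
\<close>

definition minimal :: "('n, 'k::field) mpoly free_complex \<Rightarrow> bool" where
  "minimal F \<longleftrightarrow> (\<forall>i. \<forall>r<rk F i. \<forall>c<rk F (Suc i). Poly_Mapping.lookup (diff F i $$ (r, c)) 0 = 0)"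

text \<open>In \<open>ereal\<close> the supremum of the empty set is \<open>-\<infinity>\<close>. The value \<open>\<infinity>\<close> does not occur.\<close>

definition t :: "nat \<Rightarrow> 'r free_complex \<Rightarrow> ereal" where
  "t i F = (SUP j\<in>set (twists F i). ereal (real_of_int j))"

definition subadditive :: "'r free_complex \<Rightarrow> bool" where
  "subadditive F \<longleftrightarrow> (\<forall>a b. a + b \<le> len F \<longrightarrow> t (a + b) F \<le> t a F + t b F)"


section \<open>The mapping cone of multiplication by a form\<close>

text \<open>
  \<open>lifts_mult I d f F G \<phi>\<close>: the matrices \<open>\<phi> i : G\<^sub>i(-d) \<rightarrow> F\<^sub>i\<close> form a chain map of degree \<open>0\<close>
  that lifts multiplication by \<open>f\<close>, \<open>[R/(I:f)](-d) \<rightarrow> R/I\<close>, along the augmentations.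
\<close>

definition lifts_mult ::
    "('n::finite, 'k::field) mpoly set \<Rightarrow> nat \<Rightarrow> ('n, 'k) mpoly \<Rightarrow>
     ('n, 'k) mpoly free_complex \<Rightarrow> ('n, 'k) mpoly free_complex \<Rightarrow> (nat \<Rightarrow> ('n, 'k) mpoly mat) \<Rightarrow> bool" where
  "lifts_mult I d f F G \<phi> \<longleftrightarrow>
     (\<forall>i. homogeneous_mat (twists F i) (map (\<lambda>j. j + int d) (twists G i)) (\<phi> i)) \<and>
     (\<forall>i. diff F i * \<phi> (Suc i) = \<phi> i * diff G i) \<and>
     (\<forall>v\<in>carrier_vec (rk G 0). aug F \<bullet> (\<phi> 0 *\<^sub>v v) - (aug G \<bullet> v) * f \<in> I)"

text \<open>
  The mapping cone has \<open>C\<^sub>0 = F\<^sub>0\<close> and \<open>C\<^sub>i = F\<^sub>i \<oplus> G\<^bsub>i-1\<^esub>(-d)\<close> for \<open>i \<ge> 1\<close>, with differential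
  \<open>(x, y) \<mapsto> (\<partial>\<^sup>F x + \<phi> y, -\<partial>\<^sup>G y)\<close>; in the lowest degree, \<open>C\<^sub>1 \<rightarrow> C\<^sub>0\<close>, the second component is
  absent. It is augmented to \<open>R/(I,f)\<close>.
\<close>

definition mapping_cone ::
    "nat \<Rightarrow> ('n, 'k::field) mpoly free_complex \<Rightarrow> ('n, 'k) mpoly free_complex \<Rightarrow>
     (nat \<Rightarrow> ('n, 'k) mpoly mat) \<Rightarrow> ('n, 'k) mpoly free_complex" where
  "mapping_cone d F G \<phi> =
    \<lparr> len = max (len F) (Suc (len G)),
      twists = (\<lambda>i. case i of
          0 \<Rightarrow> twists F 0
        | Suc k \<Rightarrow> twists F (Suc k) @ map (\<lambda>j. j + int d) (twists G k)),
      diff = (\<lambda>i. case i of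
          0 \<Rightarrow> four_block_mat (diff F 0) (\<phi> 0) (0\<^sub>m 0 (rk F 1)) (0\<^sub>m 0 (rk G 0))
        | Suc k \<Rightarrow> four_block_mat (diff F (Suc k)) (\<phi> (Suc k))
                     (0\<^sub>m (rk G k) (rk F (Suc (Suc k)))) (- diff G k)),
      aug = aug F \<rparr>"

text \<open>
  A bound \<open>t\<^sub>1(R/(I:f)) \<le> d\<close>, which concerns the minimal resolution, does not suffice for the cone
  of a non-minimal \<open>G\<close> to be subadditive; \<open>t 1 G \<le> d\<close> is needed for the given \<open>G\<close> as well. Take
  \<open>I = 0\<close>, \<open>f = x\<^sub>1\<close>, \<open>d = 1\<close>, \<open>F = R\<close> and \<open>G = (R(-2) \<rightarrow> R(-2) \<rightarrow> R)\<close> with maps \<open>1\<close> and \<open>0\<close>: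
  \<open>F\<close> and \<open>G\<close> are subadditive, but the cone has \<open>t\<^sub>1 = 1\<close> and \<open>t\<^sub>2 = 3\<close>.
\<close>

end

theory Submission
  imports Defs
begin

text \<open>
  Write \<open>C\<close> for the cone, so that \<open>t\<^sub>0(C) = t\<^sub>0(F)\<close> and \<open>t\<^sub>i(C) = max {t\<^sub>i(F), t\<^bsub>i-1\<^esub>(G) + d}\<close> for
  \<open>i \<ge> 1\<close>. If \<open>a = 0\<close> or \<open>b = 0\<close>, the inequality says that \<open>t\<^sub>0(F) \<ge> 0\<close>, which subadditivity of \<open>F\<close>
  yields as \<open>F\<^sub>0 \<noteq> 0\<close>. For \<open>a, b \<ge> 1\<close> the only new term is
  \<open>t\<^bsub>a+b-1\<^esub>(G) + d \<le> (t\<^bsub>a-1\<^esub>(G) + d) + t\<^sub>b(G)\<close>, and \<open>t\<^sub>b(G) \<le> t\<^bsub>b-1\<^esub>(G) + t\<^sub>1(G) \<le> t\<^bsub>b-1\<^esub>(G) + d\<close>.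
\<close>

lemma t_eq_bot: "twists F i = [] \<Longrightarrow> t i F = -\<infinity>"
  by (simp add: t_def bot_ereal_def)

lemma graded_free_resolution_t_beyond:
  assumes "graded_free_resolution J F" and "len F < i"
  shows "t i F = -\<infinity>"
proof (rule t_eq_bot)
  have "\<forall>i>len F. twists F i = []"
    using assms(1) unfolding graded_free_resolution_def by (elim conjE)
  then show "twists F i = []"
    using assms(2) by blast
qed

text \<open>If \<open>F\<close> had rank 0 in degree 0, the augmentation would be zero, and its
  surjectivity onto \<open>R/J\<close> would put every polynomial, in particular \<open>f\<close>,
  into \<open>J\<close>.\<close>

lemma graded_free_resolution_twists_0:
  assumes "graded_free_resolution J F" and "f \<notin> J"
  shows "twists F 0 \<noteq> []"
proof
  assume empty: "twists F 0 = []"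
  have "\<forall>g. \<exists>v\<in>carrier_vec (rk F 0). g - aug F \<bullet> v \<in> J"
    using assms(1) unfolding graded_free_resolution_def by (elim conjE)
  then obtain v where v: "v \<in> carrier_vec (rk F 0)" "f - aug F \<bullet> v \<in> J"
    by blast
  have "aug F \<bullet> v = 0"
    using v(1) empty by (simp add: scalar_prod_def)
  then show False
    using v(2) assms(2) by simp
qed

lemma subadditiveD: "subadditive F \<Longrightarrow> a + b \<le> len F \<Longrightarrow> t (a + b) F \<le> t a F + t b F"
  by (simp add: subadditive_def)

text \<open>A nonempty finite supremum is attained, so \<open>t 0 F\<close> is a real number and can
  be cancelled from \<open>t 0 F \<le> t 0 F + t 0 F\<close>, the case \<open>a = b = 0\<close> of
  subadditivity.\<close>

lemma t_0_nonneg: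
  assumes "subadditive F" and "twists F 0 \<noteq> []"
  shows "0 \<le> t 0 F"
proof -
  have "t 0 F = Max ((\<lambda>j. ereal (real_of_int j)) ` set (twists F 0))"
    unfolding t_def using assms(2) by (intro Max_Sup [symmetric]) auto
  also have "\<dots> \<in> (\<lambda>j. ereal (real_of_int j)) ` set (twists F 0)"
    using assms(2) by (intro Max_in) auto
  finally obtain j where "t 0 F = ereal (real_of_int j)"
    by blast
  moreover have "t 0 F \<le> t 0 F + t 0 F"
    using subadditiveD [OF assms(1), of 0 0] by simp
  ultimately show ?thesis
    by simp
qed

lemma t_mapping_cone_0: "t 0 (mapping_cone d F G \<phi>) = t 0 F"
  by (simp add: t_def mapping_cone_def)

text \<open>Since \<open>c\<close> is finite, the shift also holds over the empty set, where both
  sides are \<open>-\<infinity>\<close>; this covers a vanishing module of \<open>G\<close>.\<close>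

lemma SUP_ereal_shift:
  "(SUP x\<in>A. g x + ereal c) = (SUP x\<in>A. g x) + ereal c"
  by (cases "A = {}") (simp_all add: bot_ereal_def SUP_ereal_add_left)

lemma t_mapping_cone_Suc:
  "t (Suc k) (mapping_cone d F G \<phi>) = max (t (Suc k) F) (t k G + ereal (real d))"
proof -
  have "(SUP j\<in>(\<lambda>j. j + int d) ` set (twists G k). ereal (real_of_int j)) = t k G + ereal (real d)"
    by (simp only: t_def image_image SUP_ereal_shift of_int_add of_int_of_nat_eq
        plus_ereal.simps(1) [symmetric])
  then show ?thesis
    by (simp add: t_def mapping_cone_def SUP_union sup_max)
qed

theorem theorem2p1:
  fixes I :: "('n::finite, 'k::field) mpoly set"
    and f :: "('n, 'k) mpoly"
    and d :: nat
    and F G H :: "('n, 'k) mpoly free_complex"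
    and \<phi> :: "nat \<Rightarrow> ('n, 'k) mpoly mat"
  assumes "homogeneous_ideal I"
    and "homogeneous (int d) f" and "d > 0" and "f \<notin> I"
    and "graded_free_resolution (colon I f) H" and "minimal H" and "t 1 H \<le> ereal (real d)"
    and "graded_free_resolution I F"
    and "graded_free_resolution (colon I f) G" and "t 1 G \<le> ereal (real d)"
    and "subadditive F" and "subadditive G"
    and "lifts_mult I d f F G \<phi>"
  shows "subadditive (mapping_cone d F G \<phi>)"
proof -
  let ?C = "mapping_cone d F G \<phi>"
  have F_le: "t i F \<le> t i ?C" for i
    by (cases i) (simp_all add: t_mapping_cone_0 t_mapping_cone_Suc)
  have t0: "0 \<le> t 0 ?C"
    unfolding t_mapping_cone_0
    by (rule t_0_nonneg [OF \<open>subadditive F\<close> graded_free_resolution_twists_0])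
      (fact \<open>graded_free_resolution I F\<close> \<open>f \<notin> I\<close>)+
  \<comment> \<open>No bound by \<open>len ?C\<close> is imposed. \<open>F\<close> and
    \<open>G\<close> may differ in length, and beyond its own length each contributes only
    \<open>-\<infinity>\<close> to the left-hand side.\<close>
  have step: "t (Suc k + Suc l) ?C \<le> t (Suc k) ?C + t (Suc l) ?C" for k l
  proof -
    have "t (Suc k + Suc l) F \<le> t (Suc k) F + t (Suc l) F"
    proof (cases "Suc k + Suc l \<le> len F")
      case True
      then show ?thesis
        by (rule subadditiveD [OF \<open>subadditive F\<close>])
    next
      case False
      then have "t (Suc k + Suc l) F = -\<infinity>"
        using graded_free_resolution_t_beyond [OF \<open>graded_free_resolution I F\<close>] by simp
      then show ?thesis
        by simp
    qed
    also have "\<dots> \<le> t (Suc k) ?C + t (Suc l) ?C"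
      by (intro add_mono F_le)
    finally have F: "t (Suc k + Suc l) F \<le> t (Suc k) ?C + t (Suc l) ?C" .
    have G: "t (k + Suc l) G + ereal (real d) \<le> t (Suc k) ?C + t (Suc l) ?C"
    proof (cases "k + Suc l \<le> len G")
      case True
      have "t (l + 1) G \<le> t l G + t 1 G"
        using True by (intro subadditiveD [OF \<open>subadditive G\<close>]) simp
      also have "\<dots> \<le> t l G + ereal (real d)"
        using \<open>t 1 G \<le> ereal (real d)\<close> by (rule add_left_mono)
      also have "\<dots> \<le> t (Suc l) ?C"
        by (simp add: t_mapping_cone_Suc)
      finally have l: "t (Suc l) G \<le> t (Suc l) ?C"
        by simp
      \<comment> \<open>The twist \<open>d\<close> goes with \<open>t k G\<close>, giving a summand
        of the cone in degree \<open>Suc k\<close>; the untwisted \<open>t (Suc l) G\<close> is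
        covered by \<open>l\<close>.\<close>
      have "t (k + Suc l) G + ereal (real d) \<le> t k G + t (Suc l) G + ereal (real d)"
        using True by (intro add_right_mono subadditiveD [OF \<open>subadditive G\<close>])
      also have "\<dots> = (t k G + ereal (real d)) + t (Suc l) G"
        by (simp add: ac_simps)
      also have "\<dots> \<le> t (Suc k) ?C + t (Suc l) ?C"
        by (intro add_mono l) (simp add: t_mapping_cone_Suc)
      finally show ?thesis .
    next
      case False
      then have "t (k + Suc l) G = -\<infinity>"
        using graded_free_resolution_t_beyond [OF \<open>graded_free_resolution (colon I f) G\<close>] by simp
      then show ?thesis
        by simp
    qed
    show ?thesis
      using F G t_mapping_cone_Suc [of "k + Suc l" d F G \<phi>] by simp
  qed
  have "t (a + b) ?C \<le> t a ?C + t b ?C" for a b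
  proof (cases "a = 0 \<or> b = 0")
    case True
    then show ?thesis
      using t0 by (auto intro: add_increasing add_increasing2)
  next
    case False
    then show ?thesis
      by (metis step not0_implies_Suc)
  qed
  then show ?thesis
    unfolding subadditive_def by blast
qed

end
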